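(* Let $R$ be a ring and let $\alpha:R\to R$ be a ring endomorphism. Then $R$ is a $UJ^{\#}$ ring if and only if $R[[x;\alpha]]$ is a $UJ^{\#}$ ring.
   Context: All rings are associative with identity (and endomorphisms preserve the identity). $J(R)$ is the Jacobson radical and $U(R)$ the group of units of $R$. Define $J^{\#}(R)=\{z\in R : z^n\in J(R)\text{ for some } n\ge 1\}$. A ring $R$ is called a $UJ^{\#}$ ring if $U(R)=1+J^{\#}(R)$. $R[[x;\alpha]]$ is the ring of skew formal power series in $x$ with coefficients in $R$ (written on the left) and multiplication determined by $xr=\alpha(r)x$ for $r\in R$. *)

theory Defs
  imports "HOL-Algebra.Ring" "HOL-Algebra.AbelCoset"
begin

section \<open>Jacobson radical\<close>

text \<open>The ideals of HOL-Algebra are two-sided; over a non-commutative ring the Jacobson radical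
  is the intersection of the maximal one-sided (here: left) ideals.\<close>

locale left_ideal = additive_subgroup I R + ring R for I and R (structure) +
  assumes I_l_closed: "\<lbrakk>a \<in> I; x \<in> carrier R\<rbrakk> \<Longrightarrow> x \<otimes> a \<in> I"

locale maximal_left_ideal = left_ideal +
  assumes I_notcarr: "carrier R \<noteq> I"
    and I_maximal: "\<lbrakk>left_ideal J R; I \<subseteq> J; J \<subseteq> carrier R\<rbrakk> \<Longrightarrow> J = I \<or> J = carrier R"

text \<open>The condition \<open>x \<in> carrier R\<close> makes the empty intersection (zero ring) the whole carrier.\<close>

definition jacobson_radical :: "('a, 'm) ring_scheme \<Rightarrow> 'a set" where
  "jacobson_radical R = {x \<in> carrier R. \<forall>M. maximal_left_ideal M R \<longrightarrow> x \<in> M}"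

definition jacobson_sharp :: "('a, 'm) ring_scheme \<Rightarrow> 'a set" where
  "jacobson_sharp R =
     {z \<in> carrier R. \<exists>n::nat. n \<ge> 1 \<and> z [^]\<^bsub>R\<^esub> n \<in> jacobson_radical R}"

locale UJ_sharp_ring = ring +
  assumes Units_eq: "Units R = \<one> <+\<^bsub>R\<^esub> jacobson_sharp R"

section \<open>Skew power series\<close>

text \<open>The series \<open>\<Sum>n. f n x\<^sup>n\<close>, with coefficients on the left, is represented by its coefficient
  sequence \<open>f\<close>.  The product comes from \<open>(a x\<^sup>i) (b x\<^sup>j) = a \<alpha>\<^sup>i(b) x\<^sup>i\<^sup>+\<^sup>j\<close>.\<close>

definition skew_fps :: "('a, 'm) ring_scheme \<Rightarrow> ('a \<Rightarrow> 'a) \<Rightarrow> (nat \<Rightarrow> 'a) ring" where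
  "skew_fps R \<alpha> =
    \<lparr>carrier = UNIV \<rightarrow> carrier R,
     mult = \<lambda>f g n. \<Oplus>\<^bsub>R\<^esub>i\<in>{..n}. f i \<otimes>\<^bsub>R\<^esub> (\<alpha> ^^ i) (g (n - i)),
     one = \<lambda>n. if n = 0 then \<one>\<^bsub>R\<^esub> else \<zero>\<^bsub>R\<^esub>,
     zero = \<lambda>n. \<zero>\<^bsub>R\<^esub>,
     add = \<lambda>f g n. f n \<oplus>\<^bsub>R\<^esub> g n\<rparr>"

definition skew_const :: "('a, 'm) ring_scheme \<Rightarrow> 'a \<Rightarrow> nat \<Rightarrow> 'a" where
  "skew_const R r = (\<lambda>n. if n = 0 then r else \<zero>\<^bsub>R\<^esub>)"

definition skew_X :: "('a, 'm) ring_scheme \<Rightarrow> nat \<Rightarrow> 'a" where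
  "skew_X R = (\<lambda>n. if n = 1 then \<one>\<^bsub>R\<^esub> else \<zero>\<^bsub>R\<^esub>)"

context ring
begin

context
  fixes \<alpha> assumes endo: "\<alpha> \<in> ring_hom R R"
begin

lemma funpow_endo: "\<alpha> ^^ n \<in> ring_hom R R"
proof (induction n)
  case 0
  show ?case by (auto intro!: ring_hom_memI)
next
  case (Suc n)
  with endo show ?case
    by (auto intro!: ring_hom_memI simp: ring_hom_closed ring_hom_mult ring_hom_add ring_hom_one)
qed

lemma funpow_endo_simps [simp]:
  "x \<in> carrier R \<Longrightarrow> (\<alpha> ^^ n) x \<in> carrier R"
  "\<lbrakk>x \<in> carrier R; y \<in> carrier R\<rbrakk> \<Longrightarrow> (\<alpha> ^^ n) (x \<oplus> y) = (\<alpha> ^^ n) x \<oplus> (\<alpha> ^^ n) y"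
  "\<lbrakk>x \<in> carrier R; y \<in> carrier R\<rbrakk> \<Longrightarrow> (\<alpha> ^^ n) (x \<otimes> y) = (\<alpha> ^^ n) x \<otimes> (\<alpha> ^^ n) y"
  "(\<alpha> ^^ n) \<one> = \<one>"
  "(\<alpha> ^^ n) \<zero> = \<zero>"
proof -
  show closed: "x \<in> carrier R \<Longrightarrow> (\<alpha> ^^ n) x \<in> carrier R" for x
    by (rule ring_hom_closed[OF funpow_endo])
  show add: "\<lbrakk>x \<in> carrier R; y \<in> carrier R\<rbrakk> \<Longrightarrow> (\<alpha> ^^ n) (x \<oplus> y) = (\<alpha> ^^ n) x \<oplus> (\<alpha> ^^ n) y" for x y
    by (rule ring_hom_add[OF funpow_endo])
  show "\<lbrakk>x \<in> carrier R; y \<in> carrier R\<rbrakk> \<Longrightarrow> (\<alpha> ^^ n) (x \<otimes> y) = (\<alpha> ^^ n) x \<otimes> (\<alpha> ^^ n) y"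
    by (rule ring_hom_mult[OF funpow_endo])
  show "(\<alpha> ^^ n) \<one> = \<one>"
    by (rule ring_hom_one[OF funpow_endo])
  show "(\<alpha> ^^ n) \<zero> = \<zero>"
    by (rule ring_hom_zero[OF funpow_endo ring_axioms ring_axioms])
qed

lemma funpow_endo_finsum:
  "finite A \<Longrightarrow> f \<in> A \<rightarrow> carrier R \<Longrightarrow> (\<alpha> ^^ n) (\<Oplus>i\<in>A. f i) = (\<Oplus>i\<in>A. (\<alpha> ^^ n) (f i))"
  by (induction A rule: finite_induct) (auto simp: Pi_iff)

lemma finsum_triangle:
  assumes F: "\<And>i j. F i j \<in> carrier R"
  shows "(\<Oplus>k\<in>{..n::nat}. \<Oplus>i\<in>{..k}. F i (k - i)) = (\<Oplus>i\<in>{..n}. \<Oplus>j\<in>{..n - i}. F i j)"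
proof (induction n)
  case 0
  show ?case using F by simp
next
  case (Suc n)
  have "(\<Oplus>i\<in>{..n}. \<Oplus>j\<in>{..Suc n - i}. F i j)
      = (\<Oplus>i\<in>{..n}. F i (Suc n - i) \<oplus> (\<Oplus>j\<in>{..n - i}. F i j))"
    using F by (intro finsum_cong') (auto simp: Suc_diff_le)
  also have "\<dots> = (\<Oplus>i\<in>{..n}. F i (Suc n - i)) \<oplus> (\<Oplus>i\<in>{..n}. \<Oplus>j\<in>{..n - i}. F i j)"
    using F by (subst finsum_addf) auto
  finally show ?case
    using F Suc by (simp add: a_ac)
qed

theorem skew_fps_is_ring: "ring (skew_fps R \<alpha>)"
proof (rule ringI)
  show "abelian_group (skew_fps R \<alpha>)"
  proof (rule abelian_groupI)
    fix f assume "f \<in> carrier (skew_fps R \<alpha>)"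
    then show "\<exists>g\<in>carrier (skew_fps R \<alpha>). g \<oplus>\<^bsub>skew_fps R \<alpha>\<^esub> f = \<zero>\<^bsub>skew_fps R \<alpha>\<^esub>"
      by (intro bexI[of _ "\<lambda>n. \<ominus> f n"]) (auto simp: skew_fps_def fun_eq_iff Pi_iff l_neg)
  qed (auto simp: skew_fps_def fun_eq_iff Pi_iff a_ac)
  show "monoid (skew_fps R \<alpha>)"
  proof (rule monoidI)
    fix f g h
    assume fgh: "f \<in> carrier (skew_fps R \<alpha>)" "g \<in> carrier (skew_fps R \<alpha>)" "h \<in> carrier (skew_fps R \<alpha>)"
    have [simp]: "f i \<in> carrier R" "g i \<in> carrier R" "h i \<in> carrier R" for i
      using fgh by (auto simp: skew_fps_def Pi_iff)
    have "(\<Oplus>k\<in>{..n}. (\<Oplus>i\<in>{..k}. f i \<otimes> (\<alpha> ^^ i) (g (k - i))) \<otimes> (\<alpha> ^^ k) (h (n - k)))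
        = (\<Oplus>i\<in>{..n}. f i \<otimes> (\<alpha> ^^ i) (\<Oplus>j\<in>{..n - i}. g j \<otimes> (\<alpha> ^^ j) (h (n - i - j))))"
      (is "?L = ?R") for n
    proof -
      define F where "F i j = f i \<otimes> (\<alpha> ^^ i) (g j) \<otimes> (\<alpha> ^^ (i + j)) (h (n - (i + j)))" for i j
      have F: "F i j \<in> carrier R" for i j
        by (simp add: F_def)
      have "?L = (\<Oplus>k\<in>{..n}. \<Oplus>i\<in>{..k}. F i (k - i))"
        using F by (intro finsum_cong') (auto simp: finsum_ldistr F_def intro!: finsum_cong')
      also have "\<dots> = (\<Oplus>i\<in>{..n}. \<Oplus>j\<in>{..n - i}. F i j)"
        using F by (rule finsum_triangle)
      also have "\<dots> = ?R"
        using F by (intro finsum_cong')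
          (auto simp: finsum_rdistr funpow_endo_finsum F_def funpow_add m_assoc intro!: finsum_cong')
      finally show ?thesis .
    qed
    then show "f \<otimes>\<^bsub>skew_fps R \<alpha>\<^esub> g \<otimes>\<^bsub>skew_fps R \<alpha>\<^esub> h = f \<otimes>\<^bsub>skew_fps R \<alpha>\<^esub> (g \<otimes>\<^bsub>skew_fps R \<alpha>\<^esub> h)"
      by (simp add: skew_fps_def)
  next
    fix f assume "f \<in> carrier (skew_fps R \<alpha>)"
    then have f [simp]: "f i \<in> carrier R" for i
      by (auto simp: skew_fps_def)
    have l: "(\<Oplus>i\<in>{..n}. (if i = 0 then \<one> else \<zero>) \<otimes> (\<alpha> ^^ i) (f (n - i))) =
          (\<Oplus>i\<in>{..n}. if 0 = i then f n else \<zero>)" for n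
      by (intro finsum_cong') auto
    have l': "(\<Oplus>i\<in>{..n}. if 0 = i then f n else \<zero>) = f n" for n
      by (rule finsum_singleton[where f = "\<lambda>_. f n"]) auto
    show "\<one>\<^bsub>skew_fps R \<alpha>\<^esub> \<otimes>\<^bsub>skew_fps R \<alpha>\<^esub> f = f"
      unfolding skew_fps_def ring_record_simps l l' ..
    have r: "(\<Oplus>i\<in>{..n}. f i \<otimes> (\<alpha> ^^ i) (if n - i = 0 then \<one> else \<zero>)) =
          (\<Oplus>i\<in>{..n}. if n = i then f i else \<zero>)" for n
      by (intro finsum_cong') auto
    have r': "(\<Oplus>i\<in>{..n}. if n = i then f i else \<zero>) = f n" for n
      by (rule finsum_singleton) auto
    show "f \<otimes>\<^bsub>skew_fps R \<alpha>\<^esub> \<one>\<^bsub>skew_fps R \<alpha>\<^esub> = f"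
      unfolding skew_fps_def ring_record_simps r r' ..
  qed (auto simp: skew_fps_def Pi_iff)
next
  fix f g h
  assume fgh: "f \<in> carrier (skew_fps R \<alpha>)" "g \<in> carrier (skew_fps R \<alpha>)" "h \<in> carrier (skew_fps R \<alpha>)"
  have [simp]: "f i \<in> carrier R" "g i \<in> carrier R" "h i \<in> carrier R" for i
    using fgh by (auto simp: skew_fps_def Pi_iff)
  show "(f \<oplus>\<^bsub>skew_fps R \<alpha>\<^esub> g) \<otimes>\<^bsub>skew_fps R \<alpha>\<^esub> h
      = f \<otimes>\<^bsub>skew_fps R \<alpha>\<^esub> h \<oplus>\<^bsub>skew_fps R \<alpha>\<^esub> g \<otimes>\<^bsub>skew_fps R \<alpha>\<^esub> h"
    by (auto simp: skew_fps_def fun_eq_iff l_distr)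
  show "h \<otimes>\<^bsub>skew_fps R \<alpha>\<^esub> (f \<oplus>\<^bsub>skew_fps R \<alpha>\<^esub> g)
      = h \<otimes>\<^bsub>skew_fps R \<alpha>\<^esub> f \<oplus>\<^bsub>skew_fps R \<alpha>\<^esub> h \<otimes>\<^bsub>skew_fps R \<alpha>\<^esub> g"
    by (auto simp: skew_fps_def fun_eq_iff r_distr)
qed

lemma skew_X_const:
  assumes [simp]: "r \<in> carrier R"
  shows "skew_X R \<otimes>\<^bsub>skew_fps R \<alpha>\<^esub> skew_const R r = skew_const R (\<alpha> r) \<otimes>\<^bsub>skew_fps R \<alpha>\<^esub> skew_X R"
proof -
  have [simp]: "\<alpha> r \<in> carrier R"
    using endo by (simp add: ring_hom_closed)
  have [simp]: "\<alpha> \<zero> = \<zero>"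
    by (rule ring_hom_zero[OF endo ring_axioms ring_axioms])
  have L: "(\<Oplus>i\<in>{..n}. (if i = 1 then \<one> else \<zero>) \<otimes> (\<alpha> ^^ i) (if n - i = 0 then r else \<zero>))
      = (\<Oplus>i\<in>{..n}. if n = i then (if i = 1 then \<alpha> r else \<zero>) else \<zero>)" for n
    by (intro finsum_cong') auto
  have R: "(\<Oplus>i\<in>{..n}. (if i = 0 then \<alpha> r else \<zero>) \<otimes> (\<alpha> ^^ i) (if n - i = 1 then \<one> else \<zero>))
      = (\<Oplus>i\<in>{..n}. if 0 = i then (if n = 1 then \<alpha> r else \<zero>) else \<zero>)" for n
    by (intro finsum_cong') auto
  have L': "(\<Oplus>i\<in>{..n}. if n = i then (if i = 1 then \<alpha> r else \<zero>) else \<zero>) = (if n = 1 then \<alpha> r else \<zero>)"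
    for n :: nat by (rule finsum_singleton[where f = "\<lambda>i. if i = 1 then \<alpha> r else \<zero>"]) auto
  have R': "(\<Oplus>i\<in>{..n}. if 0 = i then (if n = 1 then \<alpha> r else \<zero>) else \<zero>) = (if n = 1 then \<alpha> r else \<zero>)"
    for n :: nat by (rule finsum_singleton[where f = "\<lambda>_. if n = 1 then \<alpha> r else \<zero>"]) auto
  show ?thesis
    unfolding skew_fps_def skew_X_def skew_const_def ring_record_simps L R L' R' ..
qed

end

end

end

theory Submission
  imports Defs "HOL-Algebra.RingHom"
begin

text \<open>The constant term is a surjective ring homomorphism \<open>R[[x;\<alpha>]] \<rightarrow> R\<close>, and a series with
  constant term \<open>1\<close> is a unit.  Any surjective homomorphism \<open>h\<close> for which every preimage of \<open>1\<close> is a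
  unit reflects units, and since no proper left ideal meets \<open>h\<^sup>-\<^sup>1(1)\<close>, maximal left ideals
  correspond under \<open>h\<close>.  So \<open>U\<close>, \<open>J\<close> and \<open>J\<^sup>#\<close> of the source are the preimages of those of the
  target, and \<open>U = 1 + J\<^sup>#\<close> holds on one side iff it holds on the other.\<close>

section \<open>Left ideals\<close>

lemma (in ring) left_idealI:
  assumes sub: "I \<subseteq> carrier R" and zero: "\<zero> \<in> I"
    and add: "\<And>a b. \<lbrakk>a \<in> I; b \<in> I\<rbrakk> \<Longrightarrow> a \<oplus> b \<in> I"
    and smult: "\<And>x a. \<lbrakk>x \<in> carrier R; a \<in> I\<rbrakk> \<Longrightarrow> x \<otimes> a \<in> I"
  shows "left_ideal I R"
proof -
  have neg: "\<ominus> a \<in> I" if "a \<in> I" for a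
    using smult[of "\<ominus> \<one>" a] that sub by (auto simp: l_minus)
  have "subgroup I (add_monoid R)"
    using sub zero add neg
    by (intro add.subgroupI) (auto simp: a_inv_def)
  then have "additive_subgroup I R"
    by (rule additive_subgroup.intro)
  then show ?thesis
    using smult by (intro left_ideal.intro left_ideal_axioms.intro ring_axioms)
qed

lemma (in left_ideal) Unit_imp_carrier:
  assumes "u \<in> I" "u \<in> Units R"
  shows "I = carrier R"
proof -
  have "x \<in> I" if x: "x \<in> carrier R" for x
  proof -
    have "x \<otimes> inv u \<otimes> u \<in> I"
      using assms x by (intro I_l_closed) auto
    then show ?thesis
      using assms x by (simp add: m_assoc)
  qed
  then show ?thesis
    using a_subset by blast
qed

section \<open>The defining condition in elementwise form\<close>

lemma (in ring) mem_one_set_add_iff: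
  assumes "H \<subseteq> carrier R" "x \<in> carrier R"
  shows "x \<in> \<one> <+ H \<longleftrightarrow> x \<ominus> \<one> \<in> H"
proof
  assume "x \<in> \<one> <+ H"
  then obtain z where z: "z \<in> H" "x = \<one> \<oplus> z"
    by (auto simp: a_l_coset_def')
  then have "x \<ominus> \<one> = z"
    using assms by (auto simp: minus_eq a_comm[of \<one>] a_assoc r_neg)
  then show "x \<ominus> \<one> \<in> H"
    using z by simp
next
  assume "x \<ominus> \<one> \<in> H"
  moreover have "x = \<one> \<oplus> (x \<ominus> \<one>)"
    using assms by (simp add: minus_eq a_lcomm[of \<one>] r_neg)
  ultimately show "x \<in> \<one> <+ H"
    by (auto simp: a_l_coset_def')
qed

lemma (in ring) jacobson_sharp_subset: "jacobson_sharp R \<subseteq> carrier R"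
  by (auto simp: jacobson_sharp_def)

text \<open>Stated for single elements, the condition can be carried along a homomorphism one
  membership at a time, without computing the image of a coset.\<close>

lemma (in ring) UJ_sharp_ring_iff:
  "UJ_sharp_ring R \<longleftrightarrow> (\<forall>x\<in>carrier R. x \<in> Units R \<longleftrightarrow> x \<ominus> \<one> \<in> jacobson_sharp R)"
proof -
  have "\<one> <+ jacobson_sharp R \<subseteq> carrier R"
    using jacobson_sharp_subset by (auto simp: a_l_coset_def')
  then have "Units R = \<one> <+ jacobson_sharp R \<longleftrightarrow>
      (\<forall>x\<in>carrier R. x \<in> Units R \<longleftrightarrow> x \<in> \<one> <+ jacobson_sharp R)"
    by (auto intro: Units_closed)
  also have "\<dots> \<longleftrightarrow> (\<forall>x\<in>carrier R. x \<in> Units R \<longleftrightarrow> x \<ominus> \<one> \<in> jacobson_sharp R)"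
    by (simp add: mem_one_set_add_iff jacobson_sharp_subset)
  finally show ?thesis
    by (simp add: UJ_sharp_ring_def UJ_sharp_ring_axioms_def ring_axioms)
qed

section \<open>Unit-reflecting surjections\<close>

locale unit_lifting_hom = ring_hom_ring +
  assumes surj: "h ` carrier R = carrier S"
    and Units_over_one: "\<lbrakk>x \<in> carrier R; h x = \<one>\<^bsub>S\<^esub>\<rbrakk> \<Longrightarrow> x \<in> Units R"
begin

lemma preimageE:
  assumes "y \<in> carrier S"
  obtains x where "x \<in> carrier R" "y = h x"
  using assms surj by blast

text \<open>For the converse, lift an inverse of \<open>h x\<close> to some \<open>y\<close>. Both
  \<open>y \<otimes> x\<close> and \<open>x \<otimes> y\<close> lie over \<open>\<one>\<close>,
  hence are units, so \<open>x\<close> has a left inverse \<open>?a\<close> and a right inverse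
  \<open>?b\<close>, and these must agree.\<close>

lemma Units_iff:
  assumes x: "x \<in> carrier R"
  shows "x \<in> Units R \<longleftrightarrow> h x \<in> Units S"
proof
  assume u: "x \<in> Units R"
  have "h (inv x) \<otimes>\<^bsub>S\<^esub> h x = \<one>\<^bsub>S\<^esub>" "h x \<otimes>\<^bsub>S\<^esub> h (inv x) = \<one>\<^bsub>S\<^esub>"
    using u x by (simp_all del: hom_mult flip: hom_mult)
  moreover have "h x \<in> carrier S" "h (inv x) \<in> carrier S"
    using u x by simp_all
  ultimately show "h x \<in> Units S"
    unfolding Units_def by blast
next
  assume "h x \<in> Units S"
  then obtain z where z: "z \<in> carrier S" "z \<otimes>\<^bsub>S\<^esub> h x = \<one>\<^bsub>S\<^esub>" "h x \<otimes>\<^bsub>S\<^esub> z = \<one>\<^bsub>S\<^esub>"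
    by (auto simp: Units_def)
  then obtain y where y: "y \<in> carrier R" "z = h y"
    using preimageE by metis
  have l: "y \<otimes> x \<in> Units R" and r: "x \<otimes> y \<in> Units R"
    using x y z by (auto intro!: Units_over_one)
  let ?a = "inv (y \<otimes> x) \<otimes> y" and ?b = "y \<otimes> inv (x \<otimes> y)"
  have closed: "?a \<in> carrier R" "?b \<in> carrier R"
    using l r x y by simp_all
  have a: "?a \<otimes> x = \<one>"
    using l x y by (simp add: R.m_assoc)
  have b: "x \<otimes> ?b = \<one>"
    using r x y by (simp flip: R.m_assoc)
  have "?a = ?b"
    by (rule R.inv_unique[OF a b x closed])
  with a b closed x show "x \<in> Units R"
    unfolding Units_def by auto
qed

section \<open>Left ideals and maximal left ideals along \<open>h\<close>\<close>

lemma left_ideal_image: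
  assumes "left_ideal I R"
  shows "left_ideal (h ` I) S"
proof -
  interpret I: left_ideal I R by fact
  show ?thesis
  proof (rule S.left_idealI)
    show "h ` I \<subseteq> carrier S"
      using I.a_subset by auto
    show "\<zero>\<^bsub>S\<^esub> \<in> h ` I"
      using I.zero_closed by (metis hom_zero imageI)
  next
    fix a b assume "a \<in> h ` I" "b \<in> h ` I"
    then obtain c d where cd: "c \<in> I" "d \<in> I" "a = h c" "b = h d" by auto
    then have "a \<oplus>\<^bsub>S\<^esub> b = h (c \<oplus> d)"
      by (simp add: I.a_Hcarr)
    with cd show "a \<oplus>\<^bsub>S\<^esub> b \<in> h ` I"
      by (metis I.a_closed imageI)
  next
    fix y a assume "y \<in> carrier S" "a \<in> h ` I"
    then obtain x c where xc: "x \<in> carrier R" "y = h x" "c \<in> I" "a = h c"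
      using preimageE by blast
    then have "y \<otimes>\<^bsub>S\<^esub> a = h (x \<otimes> c)"
      by (simp add: I.a_Hcarr)
    with xc show "y \<otimes>\<^bsub>S\<^esub> a \<in> h ` I"
      by (metis I.I_l_closed imageI)
  qed
qed

lemma left_ideal_vimage:
  assumes "left_ideal I S"
  shows "left_ideal {x \<in> carrier R. h x \<in> I} R"
proof -
  interpret I: left_ideal I S by fact
  show ?thesis
    by (rule R.left_idealI) (auto simp: I.I_l_closed)
qed

text \<open>An element of \<open>I\<close> over \<open>\<one>\<close> is a unit, so it generates
  everything. Used in the contrapositive: proper left ideals have proper images.\<close>

lemma left_ideal_image_proper:
  assumes "left_ideal I R" "h ` I = carrier S"
  shows "I = carrier R"
proof -
  interpret I: left_ideal I R by fact
  obtain u where "u \<in> I" "h u = \<one>\<^bsub>S\<^esub>"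
    using assms(2) by (metis S.one_closed imageE)
  then show ?thesis
    using Units_over_one I.a_subset I.Unit_imp_carrier by blast
qed

lemma image_vimage:
  assumes "I \<subseteq> carrier S"
  shows "h ` {x \<in> carrier R. h x \<in> I} = I"
  using assms by (auto elim!: preimageE)

lemma maximal_left_ideal_vimage:
  assumes "maximal_left_ideal N S"
  shows "maximal_left_ideal {x \<in> carrier R. h x \<in> N} R" (is "maximal_left_ideal ?M R")
proof -
  interpret N: maximal_left_ideal N S by fact
  have img: "h ` ?M = N"
    using N.a_subset by (rule image_vimage)
  have "J = ?M \<or> J = carrier R"
    if J: "left_ideal J R" and sub: "?M \<subseteq> J" "J \<subseteq> carrier R" for J
  proof -
    have "h ` J = N \<or> h ` J = carrier S"
      using sub image_mono[OF sub(1), of h] img by (intro N.I_maximal left_ideal_image J) auto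
    then show ?thesis
      using sub left_ideal_image_proper[OF J] by blast
  qed
  moreover have "carrier R \<noteq> ?M"
    using img surj N.I_notcarr by metis
  ultimately show ?thesis
    using left_ideal_vimage[OF N.left_ideal_axioms]
    by (intro maximal_left_ideal.intro maximal_left_ideal_axioms.intro)
qed

text \<open>The preimage of the image is a left ideal containing \<open>M\<close>, so by maximality
  only the whole ring has to be excluded. This says that \<open>M\<close> contains the kernel of
  \<open>h\<close>.\<close>

lemma maximal_left_ideal_eq_vimage_image:
  assumes "maximal_left_ideal M R"
  shows "{x \<in> carrier R. h x \<in> h ` M} = M"
proof -
  interpret M: maximal_left_ideal M R by fact
  let ?V = "{x \<in> carrier R. h x \<in> h ` M}"
  have img: "left_ideal (h ` M) S"
    by (rule left_ideal_image) (rule M.left_ideal_axioms)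
  have "?V = M \<or> ?V = carrier R"
    using M.a_subset by (intro M.I_maximal left_ideal_vimage img) auto
  moreover have "?V \<noteq> carrier R"
  proof
    assume "?V = carrier R"
    moreover have "h ` ?V = h ` M"
      using M.a_subset by (intro image_vimage) auto
    ultimately have "h ` M = carrier S"
      using surj by metis
    then show False
      using left_ideal_image_proper[OF M.left_ideal_axioms] M.I_notcarr by simp
  qed
  ultimately show ?thesis
    by blast
qed

lemma maximal_left_ideal_image:
  assumes M: "maximal_left_ideal M R"
  shows "maximal_left_ideal (h ` M) S"
proof -
  interpret M: maximal_left_ideal M R by fact
  have "J = h ` M \<or> J = carrier S"
    if J: "left_ideal J S" and sub: "h ` M \<subseteq> J" "J \<subseteq> carrier S" for J
  proof -
    let ?V = "{x \<in> carrier R. h x \<in> J}"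
    have "?V = M \<or> ?V = carrier R"
      using sub M.a_subset by (intro M.I_maximal left_ideal_vimage J) auto
    \<comment> \<open>Since \<open>h\<close> is onto, \<open>J\<close> is recovered as the image of
      \<open>?V\<close>, so the two cases for \<open>?V\<close> yield those for
      \<open>J\<close>.\<close>
    then show ?thesis
      using image_vimage[OF sub(2)] surj by metis
  qed
  moreover have "carrier S \<noteq> h ` M"
    using left_ideal_image_proper[OF M.left_ideal_axioms] M.I_notcarr by metis
  ultimately show ?thesis
    using left_ideal_image[OF M.left_ideal_axioms]
    by (intro maximal_left_ideal.intro maximal_left_ideal_axioms.intro)
qed

lemma jacobson_radical_iff:
  assumes x: "x \<in> carrier R"
  shows "x \<in> jacobson_radical R \<longleftrightarrow> h x \<in> jacobson_radical S"
proof
  assume "x \<in> jacobson_radical R"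
  then have "h x \<in> N" if "maximal_left_ideal N S" for N
    using maximal_left_ideal_vimage[OF that] by (auto simp: jacobson_radical_def)
  then show "h x \<in> jacobson_radical S"
    using x by (auto simp: jacobson_radical_def)
next
  assume hx: "h x \<in> jacobson_radical S"
  have "x \<in> M" if M: "maximal_left_ideal M R" for M
  proof -
    \<comment> \<open>This alone only places \<open>x\<close> in \<open>M\<close> up to the kernel;
      saturation of \<open>M\<close> removes the ambiguity.\<close>
    have "h x \<in> h ` M"
      using hx maximal_left_ideal_image[OF M] by (auto simp: jacobson_radical_def)
    then show ?thesis
      using x maximal_left_ideal_eq_vimage_image[OF M] by blast
  qed
  then show "x \<in> jacobson_radical R"
    using x by (auto simp: jacobson_radical_def)
qed

lemma jacobson_sharp_iff:
  assumes "x \<in> carrier R"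
  shows "x \<in> jacobson_sharp R \<longleftrightarrow> h x \<in> jacobson_sharp S"
  using assms by (simp add: jacobson_sharp_def jacobson_radical_iff hom_nat_pow)

theorem UJ_sharp_ring_iff_target: "UJ_sharp_ring R \<longleftrightarrow> UJ_sharp_ring S"
proof -
  have "h (x \<ominus> \<one>) = h x \<ominus>\<^bsub>S\<^esub> \<one>\<^bsub>S\<^esub>" if "x \<in> carrier R" for x
    using that by (simp add: R.minus_eq S.minus_eq)
  then have "UJ_sharp_ring R \<longleftrightarrow>
      (\<forall>x\<in>carrier R. h x \<in> Units S \<longleftrightarrow> h x \<ominus>\<^bsub>S\<^esub> \<one>\<^bsub>S\<^esub> \<in> jacobson_sharp S)"
    by (simp add: R.UJ_sharp_ring_iff Units_iff jacobson_sharp_iff)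
  \<comment> \<open>By surjectivity, ranging over the values \<open>h x\<close> is ranging over all
    of \<open>S\<close>.\<close>
  also have "\<dots> \<longleftrightarrow> UJ_sharp_ring S"
    by (simp add: S.UJ_sharp_ring_iff flip: surj)
  finally show ?thesis .
qed

end

section \<open>Inverting skew power series\<close>

context ring
begin

context
  fixes \<alpha> assumes endo: "\<alpha> \<in> ring_hom R R"
begin

text \<open>The inner conditional always holds; it shows the termination prover that the index drops.\<close>

fun skew_rinv :: "(nat \<Rightarrow> 'a) \<Rightarrow> nat \<Rightarrow> 'a" where
  "skew_rinv f n =
    (if n = 0 then \<one>
     else \<ominus> (\<Oplus>i\<in>{1..n}. f i \<otimes> (\<alpha> ^^ i) (if 1 \<le> i \<and> i \<le> n then skew_rinv f (n - i) else \<zero>)))"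

declare skew_rinv.simps [simp del]

lemma skew_rinv_closed:
  assumes "\<And>i. f i \<in> carrier R"
  shows "skew_rinv f n \<in> carrier R"
proof (induction n rule: less_induct)
  case (less n)
  then show ?case
    using assms endo by (subst skew_rinv.simps) (auto intro!: finsum_closed funpow_endo_simps(1))
qed

text \<open>As \<open>f 0 = \<one>\<close>, the summand \<open>i = 0\<close> of the coefficient in
  degree \<open>n\<close> is \<open>skew_rinv f n\<close> itself. For \<open>n > 0\<close> the
  recursion chose it as the negative of the sum of the others.\<close>

lemma skew_rinv_right_inverse:
  assumes f: "f \<in> carrier (skew_fps R \<alpha>)" and one: "f 0 = \<one>"
  shows "f \<otimes>\<^bsub>skew_fps R \<alpha>\<^esub> skew_rinv f = \<one>\<^bsub>skew_fps R \<alpha>\<^esub>"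
proof
  fix n
  have [simp]: "f i \<in> carrier R" for i
    using f by (auto simp: skew_fps_def)
  have [simp]: "skew_rinv f i \<in> carrier R" for i
    by (rule skew_rinv_closed) simp
  note [simp] = funpow_endo_simps[OF endo]
  let ?t = "\<lambda>i. f i \<otimes> (\<alpha> ^^ i) (skew_rinv f (n - i))"
  have "(\<Oplus>i\<in>{..n}. ?t i) = (if n = 0 then \<one> else \<zero>)"
  proof (cases "n = 0")
    case True
    then show ?thesis
      by (simp add: one skew_rinv.simps[of f 0])
  next
    case False
    have "skew_rinv f n = \<ominus> (\<Oplus>i\<in>{1..n}. ?t i)"
      using False
      by (subst skew_rinv.simps) (auto intro!: arg_cong[of _ _ "a_inv R"] finsum_cong')
    moreover have "{..n} = insert 0 {1..n}"
      by auto
    ultimately show ?thesis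
      using False by (simp add: one l_neg)
  qed
  then show "(f \<otimes>\<^bsub>skew_fps R \<alpha>\<^esub> skew_rinv f) n = \<one>\<^bsub>skew_fps R \<alpha>\<^esub> n"
    by (simp add: skew_fps_def)
qed

lemma skew_fps_Units_over_one:
  assumes f: "f \<in> carrier (skew_fps R \<alpha>)" and one: "f 0 = \<one>"
  shows "f \<in> Units (skew_fps R \<alpha>)"
proof -
  interpret S: ring "skew_fps R \<alpha>"
    by (rule skew_fps_is_ring[OF endo])
  \<comment> \<open>The right inverse also has constant term \<open>1\<close>, so it has a right inverse itself.\<close>
  define g where "g = skew_rinv f"
  have closed: "skew_rinv p \<in> carrier (skew_fps R \<alpha>)" if "p \<in> carrier (skew_fps R \<alpha>)" for p
    using that by (auto simp: skew_fps_def Pi_iff intro: skew_rinv_closed)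
  have g: "g \<in> carrier (skew_fps R \<alpha>)" "g 0 = \<one>"
    using closed[OF f] by (simp_all add: g_def skew_rinv.simps[of f 0])
  have fg: "f \<otimes>\<^bsub>skew_fps R \<alpha>\<^esub> g = \<one>\<^bsub>skew_fps R \<alpha>\<^esub>"
    unfolding g_def by (rule skew_rinv_right_inverse[OF f one])
  have gh: "g \<otimes>\<^bsub>skew_fps R \<alpha>\<^esub> skew_rinv g = \<one>\<^bsub>skew_fps R \<alpha>\<^esub>"
    by (rule skew_rinv_right_inverse[OF g])
  \<comment> \<open>\<open>f\<close> is a left inverse of \<open>g\<close> and
    \<open>skew_rinv g\<close> a right one, so they coincide and \<open>g\<close> inverts
    \<open>f\<close> on both sides.\<close>
  have "f = skew_rinv g"
    by (rule S.inv_unique[OF fg gh g(1) f closed[OF g(1)]])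
  with fg gh f g show ?thesis
    unfolding Units_def by auto
qed

section \<open>The constant term homomorphism\<close>

lemma skew_fps_constant_term_hom: "(\<lambda>f. f 0) \<in> ring_hom (skew_fps R \<alpha>) R"
  \<comment> \<open>In degree \<open>0\<close> only the summand \<open>i = 0\<close> occurs, where
    the twist \<open>\<alpha> ^^ 0\<close> is the identity.\<close>
  by (rule ring_hom_memI) (auto simp: skew_fps_def Pi_iff)

lemma skew_fps_constant_term_surj: "(\<lambda>f. f 0) ` carrier (skew_fps R \<alpha>) = carrier R"
proof -
  have "r \<in> (\<lambda>f. f 0) ` carrier (skew_fps R \<alpha>)" if "r \<in> carrier R" for r
    \<comment> \<open>The witness has every coefficient equal to \<open>r\<close>; any series
      starting with \<open>r\<close> would do.\<close>
    using that by (intro image_eqI[of _ _ "\<lambda>_. r"]) (auto simp: skew_fps_def)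
  then show ?thesis
    by (auto simp: skew_fps_def)
qed

lemma skew_fps_unit_lifting_hom: "unit_lifting_hom (skew_fps R \<alpha>) R (\<lambda>f. f 0)"
proof (rule unit_lifting_hom.intro)
  show "ring_hom_ring (skew_fps R \<alpha>) R (\<lambda>f. f 0)"
    by (rule ring_hom_ringI2[OF skew_fps_is_ring[OF endo] ring_axioms skew_fps_constant_term_hom])
  show "unit_lifting_hom_axioms (skew_fps R \<alpha>) R (\<lambda>f. f 0)"
    using skew_fps_constant_term_surj skew_fps_Units_over_one
    by (rule unit_lifting_hom_axioms.intro)
qed

end

end

theorem proposition3p18:
  fixes R :: "('a, 'm) ring_scheme" and \<alpha> :: "'a \<Rightarrow> 'a"
  assumes "ring R" and "\<alpha> \<in> ring_hom R R"
  shows "UJ_sharp_ring R \<longleftrightarrow> UJ_sharp_ring (skew_fps R \<alpha>)"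
  using unit_lifting_hom.UJ_sharp_ring_iff_target[OF ring.skew_fps_unit_lifting_hom[OF assms]]
  by (rule sym)

end
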